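(* Let $f_0,f_1$ and the clipped dictionary $\varphi=(\varphi_1,\dots,\varphi_s)^\top$ satisfy the moment assumption of the context, and let every feature $\varphi_i$ be either even or odd about a common centre $c\in\mathbb R$. Order the features so that $\varphi=(\varphi_{\mathrm e}^{\top},\varphi_{\mathrm o}^{\top})^{\top}$ collects the even ones first, and partition $F$ and $Y$ accordingly, with diagonal blocks $F_{\mathrm{ee}},F_{\mathrm{oo}}$ and target parts $Y_{\mathrm e},Y_{\mathrm o}$. (i) (Common symmetry.) If $f_0$ and $f_1$ are both symmetric about $c$, then $Y_{\mathrm o}=0$, the cross-parity blocks of $F$ vanish, and $J(s)=Y_{\mathrm e}^{\top}F_{\mathrm{ee}}^{-1}Y_{\mathrm e}$, which is the value of the functional $J$ for the even sub-dictionary alone. In particular $J(s)=0$ at every order $s$ for a dictionary all of whose features are odd about $c$, the (clipped) linear dictionary $\{x-c\}$ included. (ii) (Mirror pair.) If $f_1(x)=f_0(2c-x)$, then $Y_{\mathrm e}=0$, the cross-parity blocks of $C_0$ and $C_1$ cancel in $F=C_0+C_1$, and $J(s)=Y_{\mathrm o}^{\top}F_{\mathrm{oo}}^{-1}Y_{\mathrm o}$. For a dictionary consisting of even features together with the clipped linear column $\varphi_{\mathrm{lin}}$, this gives $$J(s)=\frac{2(\mathbb E_0\varphi_{\mathrm{lin}})^{2}}{\mathrm{Var}_0\varphi_{\mathrm{lin}}},$$ which is zero if and only if $\mathbb E_0\varphi_{\mathrm{lin}}=0$.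
   Context: $f_0$ and $f_1$ are probability densities on $\mathbb R$; $\mathbb E_j,\mathrm{Var}_j,\mathrm{Cov}_j$ ($j=0,1$) refer to one observation $x$ with density $f_j$. A dictionary of order $s$ is a vector $\varphi=(\varphi_1,\dots,\varphi_s)^{\top}$ of real functions of $x$. Clipped means: for a fixed constant $0<\varphi_{\max}<\infty$, each $\varphi_i=\chi\circ\tilde\varphi_i$ for a raw feature $\tilde\varphi_i$, where $\chi(y)=\max(-\varphi_{\max},\min(y,\varphi_{\max}))$; in particular $|\varphi_i|\le\varphi_{\max}$. The clipped linear column is $\varphi_{\mathrm{lin}}(x)=\chi(x-c)$. Notation: $u_j=\mathbb E_j\varphi$, $C_j=\mathrm{Cov}_j\varphi$, $F=C_0+C_1$, $Y=u_1-u_0$, $J(s)=Y^{\top}F^{-1}Y$ (a quadratic form over an empty block is $0$). Moment assumption: every $\varphi_i$ has a finite second moment under $f_0$ and under $f_1$; $C_0$ is positive definite; $f_1$ vanishes wherever $f_0$ does. A function $g$ is even about $c$ if $g(2c-x)=g(x)$ for all $x$, and odd about $c$ if $g(2c-x)=-g(x)$ for all $x$. A density $f$ is symmetric about $c$ if $f(2c-x)=f(x)$ almost everywhere. *)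

theory Defs
  imports
    "HOL-Probability.Probability"
    "Jordan_Normal_Form.Gauss_Jordan_Elimination"
begin

hide_const (open) Finite_Cartesian_Product.vec Finite_Cartesian_Product.mat

abbreviation law :: "(real \<Rightarrow> real) \<Rightarrow> real measure" where
  "law f \<equiv> density lborel (\<lambda>x. ennreal (f x))"

definition prob_density :: "(real \<Rightarrow> real) \<Rightarrow> bool" where
  "prob_density f \<longleftrightarrow>
     f \<in> borel_measurable borel \<and> (\<forall>x. 0 \<le> f x) \<and>
     prob_space (law f)"

definition Mean :: "(real \<Rightarrow> real) \<Rightarrow> (real \<Rightarrow> real) \<Rightarrow> real" where
  "Mean f g = prob_space.expectation (law f) g"

definition Var :: "(real \<Rightarrow> real) \<Rightarrow> (real \<Rightarrow> real) \<Rightarrow> real" where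
  "Var f g = prob_space.variance (law f) g"

definition Cov :: "(real \<Rightarrow> real) \<Rightarrow> (real \<Rightarrow> real) \<Rightarrow> (real \<Rightarrow> real) \<Rightarrow> real" where
  "Cov f g h = Mean f (\<lambda>x. (g x - Mean f g) * (h x - Mean f h))"

definition clip :: "real \<Rightarrow> real \<Rightarrow> real" where
  "clip M y = max (- M) (min y M)"

definition clipped_lin :: "real \<Rightarrow> real \<Rightarrow> real \<Rightarrow> real" where
  "clipped_lin M c = (\<lambda>x. clip M (x - c))"

definition even_about :: "real \<Rightarrow> (real \<Rightarrow> real) \<Rightarrow> bool" where
  "even_about c g \<longleftrightarrow> (\<forall>x. g (2 * c - x) = g x)"

definition odd_about :: "real \<Rightarrow> (real \<Rightarrow> real) \<Rightarrow> bool" where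
  "odd_about c g \<longleftrightarrow> (\<forall>x. g (2 * c - x) = - g x)"

definition density_symmetric_about :: "real \<Rightarrow> (real \<Rightarrow> real) \<Rightarrow> bool" where
  "density_symmetric_about c f \<longleftrightarrow> (AE x in lborel. f (2 * c - x) = f x)"

text \<open>A dictionary of order \<open>s\<close> is a list of length \<open>s\<close>; the order \<open>0\<close> (an empty block) is allowed.\<close>

type_synonym dictionary = "(real \<Rightarrow> real) list"

definition clipped_dictionary :: "real \<Rightarrow> dictionary \<Rightarrow> bool" where
  "clipped_dictionary M \<phi> \<longleftrightarrow> (\<forall>g\<in>set \<phi>. \<exists>raw :: real \<Rightarrow> real. g = clip M \<circ> raw)"

definition mean_vec :: "(real \<Rightarrow> real) \<Rightarrow> dictionary \<Rightarrow> real Matrix.vec" where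
  "mean_vec f \<phi> = Matrix.vec (length \<phi>) (\<lambda>i. Mean f (\<phi> ! i))"

definition cov_mat :: "(real \<Rightarrow> real) \<Rightarrow> dictionary \<Rightarrow> real Matrix.mat" where
  "cov_mat f \<phi> = Matrix.mat (length \<phi>) (length \<phi>) (\<lambda>(i, j). Cov f (\<phi> ! i) (\<phi> ! j))"

definition F_mat :: "(real \<Rightarrow> real) \<Rightarrow> (real \<Rightarrow> real) \<Rightarrow> dictionary \<Rightarrow> real Matrix.mat" where
  "F_mat f0 f1 \<phi> = cov_mat f0 \<phi> + cov_mat f1 \<phi>"

definition Y_vec :: "(real \<Rightarrow> real) \<Rightarrow> (real \<Rightarrow> real) \<Rightarrow> dictionary \<Rightarrow> real Matrix.vec" where
  "Y_vec f0 f1 \<phi> = mean_vec f1 \<phi> - mean_vec f0 \<phi>"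

text \<open>The quadratic form \<open>y\<^sup>T A\<^sup>-\<^sup>1 y\<close>. Its value is unspecified if the square matrix \<open>A\<close> is singular.\<close>

definition inv_quad_form :: "real Matrix.mat \<Rightarrow> real Matrix.vec \<Rightarrow> real" where
  "inv_quad_form A y = scalar_prod y (the (mat_inverse A) *\<^sub>v y)"

definition J :: "(real \<Rightarrow> real) \<Rightarrow> (real \<Rightarrow> real) \<Rightarrow> dictionary \<Rightarrow> real" where
  "J f0 f1 \<phi> = inv_quad_form (F_mat f0 f1 \<phi>) (Y_vec f0 f1 \<phi>)"

lemma inv_quad_form_empty:
  assumes "A \<in> carrier_mat 0 0"
  shows "inv_quad_form A y = 0"
proof -
  have "A * A = 1\<^sub>m 0" using assms by auto
  then have "A \<in> Units (ring_mat TYPE(real) 0 undefined)"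
    using assms by (auto simp: Units_def ring_mat_def)
  then obtain B where B: "mat_inverse A = Some B"
    using mat_inverse(1)[OF assms] by fastforce
  then have "B \<in> carrier_mat 0 0" using mat_inverse(2)[OF assms B] by blast
  then show ?thesis by (simp add: inv_quad_form_def B scalar_prod_def)
qed

definition pos_def_mat :: "real Matrix.mat \<Rightarrow> bool" where
  "pos_def_mat A \<longleftrightarrow>
     A \<in> carrier_mat (dim_row A) (dim_row A) \<and> transpose_mat A = A \<and>
     (\<forall>v \<in> carrier_vec (dim_row A). v \<noteq> 0\<^sub>v (dim_row A) \<longrightarrow> scalar_prod v (A *\<^sub>v v) > 0)"

definition moment_assumption ::
    "(real \<Rightarrow> real) \<Rightarrow> (real \<Rightarrow> real) \<Rightarrow> dictionary \<Rightarrow> bool" where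
  "moment_assumption f0 f1 \<phi> \<longleftrightarrow>
     (\<forall>g\<in>set \<phi>. g \<in> borel_measurable borel \<and>
        integrable (law f0) (\<lambda>x. (g x)\<^sup>2) \<and> integrable (law f1) (\<lambda>x. (g x)\<^sup>2)) \<and>
     pos_def_mat (cov_mat f0 \<phi>) \<and>
     (\<forall>x. f0 x = 0 \<longrightarrow> f1 x = 0)"

end

theory Submission
  imports Defs "Jordan_Normal_Form.Determinant"
begin

text \<open>Reflection about \<open>c\<close> multiplies the mean of a feature of parity \<open>\<sigma> = \<plusminus>1\<close> by \<open>\<sigma>\<close> and the covariance
  of two features by the product of their parities, while passing from a density to its mirror image.
  If both densities are symmetric, odd means and cross-parity covariances equal their own negatives;
  for a mirror pair, even means agree and cross-parity covariances are opposite. Either way \<open>F\<close> is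
  block diagonal and \<open>Y\<close> is supported on one block. Positive definiteness of \<open>C\<^sub>0\<close> passes to \<open>F\<close> and to
  its diagonal blocks, so all the inverses exist and \<open>Y\<^sup>T F\<^sup>-\<^sup>1 Y\<close> is evaluated by solving \<open>F x = Y\<close>
  inside that block.\<close>

section \<open>Quadratic forms of inverse matrices\<close>

text \<open>A left inverse recovers \<open>x\<close> from \<open>A *\<^sub>v x\<close>, so the
  quadratic form can be evaluated from any solution of the linear system, without computing the
  inverse.\<close>

lemma inv_quad_form_solve:
  assumes A: "A \<in> carrier_mat n n" and det: "det A \<noteq> 0" and x: "x \<in> carrier_vec n"
  shows "inv_quad_form A (A *\<^sub>v x) = (A *\<^sub>v x) \<bullet> x"
proof -
  have "A \<in> Units (ring_mat TYPE(real) n undefined)"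
    by (rule det_non_zero_imp_unit[OF A det])
  \<comment> \<open>\<open>mat_inverse\<close> answers \<open>None\<close> only for non-units, so
    the \<open>the\<close> in \<open>inv_quad_form\<close> meets a genuine inverse here.\<close>
  then obtain B where B: "mat_inverse A = Some B"
    using mat_inverse(1)[OF A] by fastforce
  from mat_inverse(2)[OF A B] have BA: "B * A = 1\<^sub>m n" and Bc: "B \<in> carrier_mat n n" by auto
  have "B *\<^sub>v (A *\<^sub>v x) = (B * A) *\<^sub>v x"
    using A Bc x by simp
  also have "\<dots> = x" using BA x by simp
  finally show ?thesis by (simp add: inv_quad_form_def B)
qed

text \<open>The right-inverse half: it supplies the solution that \<open>inv_quad_form_solve\<close>
  works with.\<close>

lemma ex_solve:
  fixes A :: "real mat"
  assumes A: "A \<in> carrier_mat n n" and det: "det A \<noteq> 0" and y: "y \<in> carrier_vec n"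
  obtains x where "x \<in> carrier_vec n" "A *\<^sub>v x = y"
proof -
  have "A \<in> Units (ring_mat TYPE(real) n undefined)"
    by (rule det_non_zero_imp_unit[OF A det])
  then obtain B where B: "mat_inverse A = Some B"
    using mat_inverse(1)[OF A] by fastforce
  from mat_inverse(2)[OF A B] have AB: "A * B = 1\<^sub>m n" and Bc: "B \<in> carrier_mat n n" by auto
  have "A *\<^sub>v (B *\<^sub>v y) = (A * B) *\<^sub>v y"
    using A Bc y by simp
  also have "\<dots> = y" using AB y by simp
  finally show ?thesis using that[of "B *\<^sub>v y"] Bc y by auto
qed

lemma inv_quad_form_zero_vec:
  assumes "A \<in> carrier_mat n n" and "det A \<noteq> 0"
  shows "inv_quad_form A (0\<^sub>v n) = 0"
proof -
  have "A *\<^sub>v 0\<^sub>v n = 0\<^sub>v n" using assms(1) by auto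
  with inv_quad_form_solve[OF assms zero_carrier_vec] show ?thesis by simp
qed

lemma inv_quad_form_1x1:
  assumes A: "A \<in> carrier_mat 1 1" and nz: "A $$ (0,0) \<noteq> 0" and y: "y \<in> carrier_vec 1"
  shows "inv_quad_form A y = (y $ 0)\<^sup>2 / A $$ (0,0)"
proof -
  define x where "x = Matrix.vec 1 (\<lambda>_. y $ 0 / A $$ (0,0))"
  have x: "x \<in> carrier_vec 1" by (simp add: x_def)
  have Ax: "A *\<^sub>v x = y"
    using A y nz by (intro eq_vecI) (auto simp: x_def scalar_prod_def)
  have "det A \<noteq> 0" using A nz by (simp add: det_single)
  from inv_quad_form_solve[OF A this x] Ax show ?thesis
    using y by (simp add: x_def scalar_prod_def power2_eq_square)
qed

text \<open>A solution of the small system, padded with zeros, solves the block diagonal one, and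
  the padding adds nothing to the scalar product. Both determinant conditions are there because an
  inverse is taken on each side.\<close>

lemma inv_quad_form_block_fst:
  assumes A: "A \<in> carrier_mat n n" and D: "D \<in> carrier_mat m m"
    and det: "det A \<noteq> 0" "det (four_block_mat A (0\<^sub>m n m) (0\<^sub>m m n) D) \<noteq> 0"
    and y: "y \<in> carrier_vec n"
  shows "inv_quad_form (four_block_mat A (0\<^sub>m n m) (0\<^sub>m m n) D) (y @\<^sub>v 0\<^sub>v m) = inv_quad_form A y"
proof -
  let ?F = "four_block_mat A (0\<^sub>m n m) (0\<^sub>m m n) D"
  obtain x where x: "x \<in> carrier_vec n" and Ax: "A *\<^sub>v x = y"
    using ex_solve[OF A det(1) y] .
  have F: "?F \<in> carrier_mat (n + m) (n + m)" using A D by simp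
  have "D *\<^sub>v 0\<^sub>v m = 0\<^sub>v m" using D by auto
  then have Fx: "?F *\<^sub>v (x @\<^sub>v 0\<^sub>v m) = y @\<^sub>v 0\<^sub>v m"
    using mult_mat_vec_split[OF A D x zero_carrier_vec] Ax by simp
  have "inv_quad_form ?F (y @\<^sub>v 0\<^sub>v m) = (y @\<^sub>v 0\<^sub>v m) \<bullet> (x @\<^sub>v 0\<^sub>v m)"
    using inv_quad_form_solve[OF F det(2), of "x @\<^sub>v 0\<^sub>v m"] x Fx by simp
  also have "\<dots> = y \<bullet> x"
    using scalar_prod_append[OF y zero_carrier_vec x zero_carrier_vec] by simp
  also have "\<dots> = inv_quad_form A y"
    using inv_quad_form_solve[OF A det(1) x] Ax by simp
  finally show ?thesis .
qed

lemma inv_quad_form_block_snd: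
  assumes A: "A \<in> carrier_mat n n" and D: "D \<in> carrier_mat m m"
    and det: "det D \<noteq> 0" "det (four_block_mat A (0\<^sub>m n m) (0\<^sub>m m n) D) \<noteq> 0"
    and y: "y \<in> carrier_vec m"
  shows "inv_quad_form (four_block_mat A (0\<^sub>m n m) (0\<^sub>m m n) D) (0\<^sub>v n @\<^sub>v y) = inv_quad_form D y"
proof -
  let ?F = "four_block_mat A (0\<^sub>m n m) (0\<^sub>m m n) D"
  obtain x where x: "x \<in> carrier_vec m" and Dx: "D *\<^sub>v x = y"
    using ex_solve[OF D det(1) y] .
  have F: "?F \<in> carrier_mat (n + m) (n + m)" using A D by simp
  have "A *\<^sub>v 0\<^sub>v n = 0\<^sub>v n" using A by auto
  then have Fx: "?F *\<^sub>v (0\<^sub>v n @\<^sub>v x) = 0\<^sub>v n @\<^sub>v y"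
    using mult_mat_vec_split[OF A D zero_carrier_vec x] Dx by simp
  have "inv_quad_form ?F (0\<^sub>v n @\<^sub>v y) = (0\<^sub>v n @\<^sub>v y) \<bullet> (0\<^sub>v n @\<^sub>v x)"
    using inv_quad_form_solve[OF F det(2), of "0\<^sub>v n @\<^sub>v x"] x Fx by simp
  also have "\<dots> = y \<bullet> x"
    using scalar_prod_append[OF zero_carrier_vec y zero_carrier_vec x] by simp
  also have "\<dots> = inv_quad_form D y"
    using inv_quad_form_solve[OF D det(1) x] Dx by simp
  finally show ?thesis .
qed

text \<open>Serves to compare equal four-block matrices block by block, and to identify the blocks
  named through \<open>split_block\<close> in the final theorem.\<close>

lemma split_block_four_block_mat:
  assumes "A \<in> carrier_mat n k" "B \<in> carrier_mat n l"
    "C \<in> carrier_mat m k" "D \<in> carrier_mat m l"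
  shows "split_block (four_block_mat A B C D) n k = (A, B, C, D)"
  using assms by (auto simp: split_block_def Let_def intro!: eq_matI)

section \<open>Positive definite matrices\<close>

lemma pos_def_mat_pos:
  assumes "pos_def_mat A" "A \<in> carrier_mat n n" "v \<in> carrier_vec n" "v \<noteq> 0\<^sub>v n"
  shows "v \<bullet> (A *\<^sub>v v) > 0"
  using assms by (auto simp: pos_def_mat_def)

text \<open>A singular matrix has a nonzero kernel vector, on which the quadratic form would
  vanish.\<close>

lemma pos_def_mat_det:
  assumes pd: "pos_def_mat A" and A: "A \<in> carrier_mat n n"
  shows "det A \<noteq> 0"
proof
  assume "det A = 0"
  then obtain v where v: "v \<in> carrier_vec n" "v \<noteq> 0\<^sub>v n" "A *\<^sub>v v = 0\<^sub>v n"
    using det_0_iff_vec_prod_zero[OF A] by auto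
  with pos_def_mat_pos[OF pd A v(1,2)] show False by simp
qed

lemma pos_def_mat_1x1:
  assumes pd: "pos_def_mat A" and A: "A \<in> carrier_mat 1 1"
  shows "A $$ (0,0) > 0"
proof -
  define v :: "real vec" where "v = Matrix.vec 1 (\<lambda>_. 1)"
  have v: "v \<in> carrier_vec 1" by (simp add: v_def)
  have "v $ 0 \<noteq> 0\<^sub>v 1 $ 0" by (simp add: v_def)
  then have "v \<noteq> 0\<^sub>v 1" by metis
  from pos_def_mat_pos[OF pd A v this] show ?thesis
    using A by (simp add: v_def scalar_prod_def)
qed

text \<open>Semidefiniteness of \<open>B\<close> suffices. This matches the moment assumption, which
  makes only the covariance matrix under \<open>f0\<close> definite.\<close>

lemma pos_def_mat_add:
  assumes pd: "pos_def_mat A" and A: "A \<in> carrier_mat n n" and B: "B \<in> carrier_mat n n"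
    and sym: "transpose_mat B = B"
    and psd: "\<And>v. v \<in> carrier_vec n \<Longrightarrow> v \<bullet> (B *\<^sub>v v) \<ge> 0"
  shows "pos_def_mat (A + B)"
proof -
  have "v \<bullet> ((A + B) *\<^sub>v v) > 0" if v: "v \<in> carrier_vec n" "v \<noteq> 0\<^sub>v n" for v
  proof -
    have "v \<bullet> ((A + B) *\<^sub>v v) = v \<bullet> (A *\<^sub>v v) + v \<bullet> (B *\<^sub>v v)"
      using A B v(1)
      by (simp add: add_mult_distrib_mat_vec[OF A B v(1)] scalar_prod_add_distrib[of _ n])
    with pos_def_mat_pos[OF pd A v] psd[OF v(1)] show ?thesis by simp
  qed
  moreover have "transpose_mat A = A" using pd by (simp add: pos_def_mat_def)
  then have "transpose_mat (A + B) = A + B"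
    using A B sym by (simp add: transpose_add)
  ultimately show ?thesis using A B by (auto simp: pos_def_mat_def)
qed

text \<open>Testing the large form on a vector padded with zeros isolates one diagonal block, since
  the off-diagonal blocks only meet the zero half.\<close>

lemma pos_def_mat_blocks:
  assumes pd: "pos_def_mat (four_block_mat A B C D)"
    and A: "A \<in> carrier_mat n n" and B: "B \<in> carrier_mat n m"
    and C: "C \<in> carrier_mat m n" and D: "D \<in> carrier_mat m m"
  shows "pos_def_mat A" "pos_def_mat D"
proof -
  let ?F = "four_block_mat A B C D"
  have F: "?F \<in> carrier_mat (n + m) (n + m)" using A D by simp
  have "transpose_mat ?F = ?F" using pd by (simp add: pos_def_mat_def)
  then have "four_block_mat A\<^sup>T C\<^sup>T B\<^sup>T D\<^sup>T = ?F"
    using transpose_four_block_mat[OF A B C D] by simp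
  \<comment> \<open>Splitting both sides turns the symmetry of the whole matrix into symmetry of
    each diagonal block.\<close>
  then have "split_block (four_block_mat A\<^sup>T C\<^sup>T B\<^sup>T D\<^sup>T) n n = split_block ?F n n"
    by simp
  then have sym: "A\<^sup>T = A" "D\<^sup>T = D"
    using A B C D
    by (simp_all add: split_block_four_block_mat[where m = m and l = m])
  show "pos_def_mat A"
  proof -
    have "v \<bullet> (A *\<^sub>v v) > 0" if v: "v \<in> carrier_vec n" "v \<noteq> 0\<^sub>v n" for v
    proof -
      have "v @\<^sub>v 0\<^sub>v m \<noteq> 0\<^sub>v n @\<^sub>v 0\<^sub>v m"
        using v append_vec_eq[OF v(1) zero_carrier_vec] by auto
      then have "v @\<^sub>v 0\<^sub>v m \<noteq> 0\<^sub>v (n + m)" by auto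
      then have "0 < (v @\<^sub>v 0\<^sub>v m) \<bullet> (?F *\<^sub>v (v @\<^sub>v 0\<^sub>v m))"
        using v by (intro pos_def_mat_pos[OF pd F]) auto
      also have "\<dots> = (v @\<^sub>v 0\<^sub>v m) \<bullet> ((A *\<^sub>v v + B *\<^sub>v 0\<^sub>v m) @\<^sub>v (C *\<^sub>v v + D *\<^sub>v 0\<^sub>v m))"
        using four_block_mat_mult_vec[OF A B C D v(1) zero_carrier_vec] by simp
      also have "\<dots> = v \<bullet> (A *\<^sub>v v + B *\<^sub>v 0\<^sub>v m) + 0\<^sub>v m \<bullet> (C *\<^sub>v v + D *\<^sub>v 0\<^sub>v m)"
        using A B C D v by (intro scalar_prod_append[where ?n1.0 = n and ?n2.0 = m]) auto
      also have "B *\<^sub>v 0\<^sub>v m = 0\<^sub>v n" using B by auto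
      also have "0\<^sub>v m \<bullet> (C *\<^sub>v v + D *\<^sub>v 0\<^sub>v m) = 0"
        using C D v by (intro scalar_prod_left_zero) auto
      finally show ?thesis using A v by simp
    qed
    then show ?thesis using A sym by (auto simp: pos_def_mat_def)
  qed
  show "pos_def_mat D"
  proof -
    have "v \<bullet> (D *\<^sub>v v) > 0" if v: "v \<in> carrier_vec m" "v \<noteq> 0\<^sub>v m" for v
    proof -
      have "0\<^sub>v n @\<^sub>v v \<noteq> 0\<^sub>v n @\<^sub>v 0\<^sub>v m"
        using v append_vec_eq[OF zero_carrier_vec zero_carrier_vec] by auto
      then have "0\<^sub>v n @\<^sub>v v \<noteq> 0\<^sub>v (n + m)" by auto
      then have "0 < (0\<^sub>v n @\<^sub>v v) \<bullet> (?F *\<^sub>v (0\<^sub>v n @\<^sub>v v))"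
        using v by (intro pos_def_mat_pos[OF pd F]) auto
      also have "\<dots> = (0\<^sub>v n @\<^sub>v v) \<bullet> ((A *\<^sub>v 0\<^sub>v n + B *\<^sub>v v) @\<^sub>v (C *\<^sub>v 0\<^sub>v n + D *\<^sub>v v))"
        using four_block_mat_mult_vec[OF A B C D zero_carrier_vec v(1)] by simp
      also have "\<dots> = 0\<^sub>v n \<bullet> (A *\<^sub>v 0\<^sub>v n + B *\<^sub>v v) + v \<bullet> (C *\<^sub>v 0\<^sub>v n + D *\<^sub>v v)"
        using A B C D v by (intro scalar_prod_append[where ?n1.0 = n and ?n2.0 = m]) auto
      also have "C *\<^sub>v 0\<^sub>v n = 0\<^sub>v m" using C by auto
      also have "0\<^sub>v n \<bullet> (A *\<^sub>v 0\<^sub>v n + B *\<^sub>v v) = 0"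
        using A B v by (intro scalar_prod_left_zero) auto
      finally show ?thesis using D v by simp
    qed
    then show ?thesis using D sym by (auto simp: pos_def_mat_def)
  qed
qed

section \<open>Covariance matrices\<close>

lemma Var_eq_Cov: "Var f g = Cov f g g"
  by (simp add: Var_def Cov_def Mean_def power2_eq_square)

lemma Cov_commute: "Cov f g h = Cov f h g"
  by (simp add: Cov_def mult.commute)

section \<open>Integrability of products of square-integrable features\<close>

lemma square_integrable_imp_integrable_prod:
  fixes g h :: "'a \<Rightarrow> real"
  assumes [measurable]: "g \<in> borel_measurable N" "h \<in> borel_measurable N"
    and "integrable N (\<lambda>x. (g x)\<^sup>2)" "integrable N (\<lambda>x. (h x)\<^sup>2)"
  shows "integrable N (\<lambda>x. g x * h x)"
proof (rule Bochner_Integration.integrable_bound)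
  show "integrable N (\<lambda>x. (g x)\<^sup>2 + (h x)\<^sup>2)" using assms by simp
  show "AE x in N. norm (g x * h x) \<le> norm ((g x)\<^sup>2 + (h x)\<^sup>2)"
  proof (intro AE_I2)
    fix x
    \<comment> \<open>The pointwise arithmetic-geometric mean bound replaces Cauchy-Schwarz: it
      yields an integrable majorant of the product.\<close>
    have "2 * \<bar>g x\<bar> * \<bar>h x\<bar> \<le> \<bar>g x\<bar>\<^sup>2 + \<bar>h x\<bar>\<^sup>2" by (rule sum_squares_bound)
    moreover have "0 \<le> \<bar>g x\<bar> * \<bar>h x\<bar>" by simp
    ultimately have "\<bar>g x\<bar> * \<bar>h x\<bar> \<le> \<bar>g x\<bar>\<^sup>2 + \<bar>h x\<bar>\<^sup>2" by linarith
    then show "norm (g x * h x) \<le> norm ((g x)\<^sup>2 + (h x)\<^sup>2)"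
      by (simp add: abs_mult)
  qed
qed measurable

text \<open>On a probability space square integrability implies integrability, so subtracting a
  constant preserves the finite second moment.\<close>

lemma integrable_centred_prod:
  fixes g h :: "real \<Rightarrow> real"
  assumes f: "prob_density f"
    and g: "g \<in> borel_measurable borel" "integrable (law f) (\<lambda>x. (g x)\<^sup>2)"
    and h: "h \<in> borel_measurable borel" "integrable (law f) (\<lambda>x. (h x)\<^sup>2)"
  shows "integrable (law f) (\<lambda>x. (g x - a) * (h x - b))"
proof -
  interpret prob_space "law f" using f by (simp add: prob_density_def)
  have "integrable (law f) (\<lambda>x. (k x - d)\<^sup>2)"
    if k: "k \<in> borel_measurable borel" "integrable (law f) (\<lambda>x. (k x)\<^sup>2)"
    for k :: "real \<Rightarrow> real" and d
  proof -
    have "integrable (law f) k"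
      using square_integrable_imp_integrable[of k] k by simp
    then have "integrable (law f) (\<lambda>x. (k x)\<^sup>2 - 2 * k x * d + d\<^sup>2)"
      using k(2) by auto
    then show ?thesis by (simp add: power2_diff algebra_simps)
  qed
  then show ?thesis
    using g h by (intro square_integrable_imp_integrable_prod) auto
qed

text \<open>The rectangular companion of \<open>cov_mat\<close>: these are the off-diagonal blocks
  once a dictionary is split in two.\<close>

definition cross_cov :: "(real \<Rightarrow> real) \<Rightarrow> dictionary \<Rightarrow> dictionary \<Rightarrow> real mat" where
  "cross_cov f \<phi> \<psi> = Matrix.mat (length \<phi>) (length \<psi>) (\<lambda>(i, j). Cov f (\<phi> ! i) (\<psi> ! j))"

lemma carrier_cov [simp]:
  "cov_mat f \<phi> \<in> carrier_mat (length \<phi>) (length \<phi>)"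
  "cross_cov f \<phi> \<psi> \<in> carrier_mat (length \<phi>) (length \<psi>)"
  "F_mat f0 f1 \<phi> \<in> carrier_mat (length \<phi>) (length \<phi>)"
  "Y_vec f0 f1 \<phi> \<in> carrier_vec (length \<phi>)"
  by (auto simp: cov_mat_def cross_cov_def F_mat_def Y_vec_def mean_vec_def)

lemma dim_Y_vec [simp]: "dim_vec (Y_vec f0 f1 \<phi>) = length \<phi>"
  using carrier_cov(4)[of f0 f1 \<phi>] by simp

lemma cov_mat_append:
  "cov_mat f (\<phi> @ \<psi>) =
    four_block_mat (cov_mat f \<phi>) (cross_cov f \<phi> \<psi>) (cross_cov f \<psi> \<phi>) (cov_mat f \<psi>)"
  by (rule eq_matI) (auto simp: cov_mat_def cross_cov_def nth_append)

lemma F_mat_append: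
  "F_mat f0 f1 (\<phi> @ \<psi>) =
    four_block_mat (F_mat f0 f1 \<phi>) (cross_cov f0 \<phi> \<psi> + cross_cov f1 \<phi> \<psi>)
      (cross_cov f0 \<psi> \<phi> + cross_cov f1 \<psi> \<phi>) (F_mat f0 f1 \<psi>)"
  unfolding F_mat_def cov_mat_append
  by (rule add_four_block_mat) (rule carrier_cov)+

lemma Y_vec_append: "Y_vec f0 f1 (\<phi> @ \<psi>) = Y_vec f0 f1 \<phi> @\<^sub>v Y_vec f0 f1 \<psi>"
  by (rule eq_vecI) (auto simp: Y_vec_def mean_vec_def nth_append)

text \<open>The form is the variance of the linear combination of features with coefficients
  \<open>v\<close>, hence the integral of a square.\<close>

lemma cov_mat_quad_form_nonneg:
  assumes f: "prob_density f"
    and \<phi>: "\<forall>g\<in>set \<phi>. g \<in> borel_measurable borel \<and> integrable (law f) (\<lambda>x. (g x)\<^sup>2)"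
    and v: "v \<in> carrier_vec (length \<phi>)"
  shows "v \<bullet> (cov_mat f \<phi> *\<^sub>v v) \<ge> 0"
proof -
  let ?I = "{0..<length \<phi>}"
  define h where "h i x = (\<phi> ! i) x - Mean f (\<phi> ! i)" for i x
  \<comment> \<open>This is what permits moving both finite sums under the integral.\<close>
  have int: "integrable (law f) (\<lambda>x. h i x * h j x)" if "i \<in> ?I" "j \<in> ?I" for i j
    unfolding h_def using that \<phi> by (intro integrable_centred_prod[OF f]) auto
  have "v \<bullet> (cov_mat f \<phi> *\<^sub>v v) = (\<Sum>i\<in>?I. \<Sum>j\<in>?I. v $ i * v $ j * Cov f (\<phi> ! i) (\<phi> ! j))"
    using v by (auto simp: scalar_prod_def cov_mat_def sum_distrib_left mult_ac intro!: sum.cong)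
  also have "\<dots> = (\<Sum>i\<in>?I. \<Sum>j\<in>?I. \<integral>x. v $ i * v $ j * (h i x * h j x) \<partial>law f)"
    by (intro sum.cong refl) (simp add: Cov_def Mean_def h_def)
  also have "\<dots> = (\<Sum>i\<in>?I. \<integral>x. (\<Sum>j\<in>?I. v $ i * v $ j * (h i x * h j x)) \<partial>law f)"
    using int by (intro sum.cong refl Bochner_Integration.integral_sum[symmetric]) auto
  also have "\<dots> = (\<integral>x. (\<Sum>i\<in>?I. \<Sum>j\<in>?I. v $ i * v $ j * (h i x * h j x)) \<partial>law f)"
    using int
    by (intro Bochner_Integration.integral_sum[symmetric] Bochner_Integration.integrable_sum) auto
  also have "\<dots> = (\<integral>x. (\<Sum>i\<in>?I. v $ i * h i x)\<^sup>2 \<partial>law f)"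
    by (simp add: power2_eq_square sum_product mult_ac)
  also have "\<dots> \<ge> 0" by simp
  finally show ?thesis .
qed

lemma pos_def_F_mat:
  assumes "prob_density f1" and mom: "moment_assumption f0 f1 \<phi>"
  shows "pos_def_mat (F_mat f0 f1 \<phi>)"
  unfolding F_mat_def
proof (rule pos_def_mat_add)
  show "pos_def_mat (cov_mat f0 \<phi>)" using mom by (simp add: moment_assumption_def)
  show "(cov_mat f1 \<phi>)\<^sup>T = cov_mat f1 \<phi>"
    by (rule eq_matI) (auto simp: cov_mat_def Cov_commute)
  show "v \<bullet> (cov_mat f1 \<phi> *\<^sub>v v) \<ge> 0" if "v \<in> carrier_vec (length \<phi>)" for v
    using assms that by (intro cov_mat_quad_form_nonneg) (auto simp: moment_assumption_def)
qed auto

text \<open>The covariance matrix of a sub-dictionary is a diagonal block of the full one and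
  inherits its definiteness, so \<open>J\<close> of either part also uses a true inverse.\<close>

lemma moment_assumption_appendD:
  assumes mom: "moment_assumption f0 f1 (\<phi> @ \<psi>)"
  shows "moment_assumption f0 f1 \<phi>" "moment_assumption f0 f1 \<psi>"
proof -
  have pd: "pos_def_mat (four_block_mat (cov_mat f0 \<phi>) (cross_cov f0 \<phi> \<psi>)
      (cross_cov f0 \<psi> \<phi>) (cov_mat f0 \<psi>))"
    using mom by (simp add: moment_assumption_def cov_mat_append)
  note pos_def_mat_blocks[OF pd carrier_cov(1) carrier_cov(2) carrier_cov(2) carrier_cov(1)]
  with mom show "moment_assumption f0 f1 \<phi>" "moment_assumption f0 f1 \<psi>"
    by (auto simp: moment_assumption_def)
qed

text \<open>With \<open>F\<close> block diagonal and \<open>Y\<close> zero on the second block, the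
  system \<open>F x = Y\<close> is solved inside the first block.\<close>

lemma J_append_fst:
  assumes f: "prob_density f1" and mom: "moment_assumption f0 f1 (\<phi> @ \<psi>)"
    and "cross_cov f0 \<phi> \<psi> + cross_cov f1 \<phi> \<psi> = 0\<^sub>m (length \<phi>) (length \<psi>)"
    and "cross_cov f0 \<psi> \<phi> + cross_cov f1 \<psi> \<phi> = 0\<^sub>m (length \<psi>) (length \<phi>)"
    and "Y_vec f0 f1 \<psi> = 0\<^sub>v (length \<psi>)"
  shows "J f0 f1 (\<phi> @ \<psi>) = J f0 f1 \<phi>"
  unfolding J_def F_mat_append Y_vec_append assms(3-5)
proof (rule inv_quad_form_block_fst)
  show "det (F_mat f0 f1 \<phi>) \<noteq> 0"
    by (rule pos_def_mat_det[OF pos_def_F_mat[OF f moment_assumption_appendD(1)[OF mom]] carrier_cov(3)])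
  show "det (four_block_mat (F_mat f0 f1 \<phi>) (0\<^sub>m (length \<phi>) (length \<psi>))
      (0\<^sub>m (length \<psi>) (length \<phi>)) (F_mat f0 f1 \<psi>)) \<noteq> 0"
    using pos_def_mat_det[OF pos_def_F_mat[OF f mom] carrier_cov(3)]
    by (simp add: F_mat_append assms(3,4))
qed auto

lemma J_append_snd:
  assumes f: "prob_density f1" and mom: "moment_assumption f0 f1 (\<phi> @ \<psi>)"
    and "cross_cov f0 \<phi> \<psi> + cross_cov f1 \<phi> \<psi> = 0\<^sub>m (length \<phi>) (length \<psi>)"
    and "cross_cov f0 \<psi> \<phi> + cross_cov f1 \<psi> \<phi> = 0\<^sub>m (length \<psi>) (length \<phi>)"
    and "Y_vec f0 f1 \<phi> = 0\<^sub>v (length \<phi>)"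
  shows "J f0 f1 (\<phi> @ \<psi>) = J f0 f1 \<psi>"
  unfolding J_def F_mat_append Y_vec_append assms(3-5)
proof (rule inv_quad_form_block_snd)
  show "det (F_mat f0 f1 \<psi>) \<noteq> 0"
    by (rule pos_def_mat_det[OF pos_def_F_mat[OF f moment_assumption_appendD(2)[OF mom]] carrier_cov(3)])
  show "det (four_block_mat (F_mat f0 f1 \<phi>) (0\<^sub>m (length \<phi>) (length \<psi>))
      (0\<^sub>m (length \<psi>) (length \<phi>)) (F_mat f0 f1 \<psi>)) \<noteq> 0"
    using pos_def_mat_det[OF pos_def_F_mat[OF f mom] carrier_cov(3)]
    by (simp add: F_mat_append assms(3,4))
qed auto

text \<open>Stated with a nonzero denominator in place of the moment assumption, so that it also
  covers the linear column on its own, about which the theorem assumes no moments.\<close>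

lemma J_singleton:
  assumes "Cov f0 g g + Cov f1 g g \<noteq> 0"
  shows "J f0 f1 [g] = (Mean f1 g - Mean f0 g)\<^sup>2 / (Cov f0 g g + Cov f1 g g)"
proof -
  have "F_mat f0 f1 [g] $$ (0,0) = Cov f0 g g + Cov f1 g g"
    by (simp add: F_mat_def cov_mat_def)
  moreover have "Y_vec f0 f1 [g] $ 0 = Mean f1 g - Mean f0 g"
    by (simp add: Y_vec_def mean_vec_def)
  ultimately show ?thesis
    using inv_quad_form_1x1[of "F_mat f0 f1 [g]" "Y_vec f0 f1 [g]"] assms
      carrier_cov(3)[of f0 f1 "[g]"] carrier_cov(4)[of f0 f1 "[g]"]
    by (simp add: J_def)
qed

section \<open>Reflection\<close>

text \<open>Lebesgue measure is invariant under reflection about \<open>c\<close>. Taking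
  \<open>f' = f\<close> gives the symmetric case, \<open>f' = f1\<close> with \<open>f = f0\<close>
  the mirror pair; the almost-everywhere form serves both.\<close>

lemma Mean_reflect:
  assumes f: "prob_density f" "prob_density f'" and refl: "AE x in lborel. f' x = f (2 * c - x)"
    and g: "g \<in> borel_measurable borel"
  shows "Mean f' g = Mean f (\<lambda>x. g (2 * c - x))"
proof -
  have [measurable]: "f \<in> borel_measurable borel" "f' \<in> borel_measurable borel"
      "g \<in> borel_measurable borel"
    and nn: "\<And>x. 0 \<le> f x" "\<And>x. 0 \<le> f' x"
    using f g by (auto simp: prob_density_def)
  have "Mean f' g = (\<integral>x. f' x * g x \<partial>lborel)"
    unfolding Mean_def using nn by (subst integral_density) auto
  also have "\<dots> = (\<integral>x. f (2 * c - x) * g x \<partial>lborel)"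
    using refl by (intro integral_cong_AE) auto
  \<comment> \<open>Affine substitution with slope -1 and offset \<open>2 * c\<close>; the double
    reflection inside \<open>g\<close> cancels.\<close>
  also have "\<dots> = (\<integral>x. f x * g (2 * c - x) \<partial>lborel)"
    using lborel_integral_real_affine[of "-1" "\<lambda>x. f x * g (2 * c - x)" "2 * c"] by simp
  also have "\<dots> = Mean f (\<lambda>x. g (2 * c - x))"
    unfolding Mean_def using nn by (subst integral_density) auto
  finally show ?thesis .
qed

text \<open>The factor \<open>\<sigma>\<close> encodes the parity, 1 for even and -1 for odd, so one
  computation covers both.\<close>

lemma Mean_reflect_parity:
  assumes "prob_density f" "prob_density f'" "AE x in lborel. f' x = f (2 * c - x)"
    and "g \<in> borel_measurable borel" and "\<And>x. g (2 * c - x) = \<sigma> * g x"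
  shows "Mean f' g = \<sigma> * Mean f g"
  using Mean_reflect[OF assms(1-4)] assms(5) by (simp add: Mean_def)

lemma Cov_reflect_parity:
  assumes f: "prob_density f" "prob_density f'" "AE x in lborel. f' x = f (2 * c - x)"
    and g: "g \<in> borel_measurable borel" "\<And>x. g (2 * c - x) = \<sigma> * g x"
    and h: "h \<in> borel_measurable borel" "\<And>x. h (2 * c - x) = \<tau> * h x"
  shows "Cov f' g h = \<sigma> * \<tau> * Cov f g h"
proof -
  \<comment> \<open>The means pick up the same signs as the features, so each sign factors out of
    its centred feature.\<close>
  have "Cov f' g h = Mean f (\<lambda>x. (\<sigma> * g x - \<sigma> * Mean f g) * (\<tau> * h x - \<tau> * Mean f h))"
    unfolding Cov_def Mean_reflect_parity[OF f g] Mean_reflect_parity[OF f h]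
    using g h by (subst Mean_reflect[OF f]) auto
  also have "\<dots> = Mean f (\<lambda>x. \<sigma> * \<tau> * ((g x - Mean f g) * (h x - Mean f h)))"
    by (simp add: algebra_simps)
  also have "\<dots> = \<sigma> * \<tau> * Cov f g h" by (simp add: Cov_def Mean_def)
  finally show ?thesis .
qed

lemma Mean_even:
  assumes "prob_density f" "prob_density f'" "AE x in lborel. f' x = f (2 * c - x)"
    and "g \<in> borel_measurable borel" "even_about c g"
  shows "Mean f' g = Mean f g"
  using Mean_reflect_parity[OF assms(1-4), of 1] assms(5) by (simp add: even_about_def)

lemma Mean_odd:
  assumes "prob_density f" "prob_density f'" "AE x in lborel. f' x = f (2 * c - x)"
    and "g \<in> borel_measurable borel" "odd_about c g"
  shows "Mean f' g = - Mean f g"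
  using Mean_reflect_parity[OF assms(1-4), of "-1"] assms(5) by (simp add: odd_about_def)

lemma Cov_odd_odd:
  assumes "prob_density f" "prob_density f'" "AE x in lborel. f' x = f (2 * c - x)"
    and "g \<in> borel_measurable borel" "odd_about c g"
    and "h \<in> borel_measurable borel" "odd_about c h"
  shows "Cov f' g h = Cov f g h"
  using Cov_reflect_parity[OF assms(1-4) _ assms(6), of "-1" "-1"] assms(5,7)
  by (simp add: odd_about_def)

lemma Cov_even_odd:
  assumes "prob_density f" "prob_density f'" "AE x in lborel. f' x = f (2 * c - x)"
    and "g \<in> borel_measurable borel" "even_about c g"
    and "h \<in> borel_measurable borel" "odd_about c h"
  shows "Cov f' g h = - Cov f g h"
  using Cov_reflect_parity[OF assms(1-4) _ assms(6), of 1 "-1"] assms(5,7)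
  by (simp add: even_about_def odd_about_def)

lemma cross_cov_mirror:
  assumes f: "prob_density f" "prob_density f'" "AE x in lborel. f' x = f (2 * c - x)"
    and e: "\<forall>g\<in>set \<phi>. g \<in> borel_measurable borel \<and> even_about c g"
    and o: "\<forall>g\<in>set \<psi>. g \<in> borel_measurable borel \<and> odd_about c g"
  shows "cross_cov f \<phi> \<psi> + cross_cov f' \<phi> \<psi> = 0\<^sub>m (length \<phi>) (length \<psi>)"
    and "cross_cov f \<psi> \<phi> + cross_cov f' \<psi> \<phi> = 0\<^sub>m (length \<psi>) (length \<phi>)"
proof -
  have *: "Cov f' (\<phi> ! i) (\<psi> ! j) = - Cov f (\<phi> ! i) (\<psi> ! j)"
    if "i < length \<phi>" "j < length \<psi>" for i j
    using e o that by (intro Cov_even_odd[OF f]) auto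
  show "cross_cov f \<phi> \<psi> + cross_cov f' \<phi> \<psi> = 0\<^sub>m (length \<phi>) (length \<psi>)"
    by (rule eq_matI) (auto simp: cross_cov_def *)
  show "cross_cov f \<psi> \<phi> + cross_cov f' \<psi> \<phi> = 0\<^sub>m (length \<psi>) (length \<phi>)"
    \<comment> \<open>The partial instantiation orients commutativity, moving entries of
      \<open>\<psi>\<close> to the second argument, where \<open>*\<close> applies.\<close>
    by (rule eq_matI) (auto simp: cross_cov_def Cov_commute[of _ "\<psi> ! _"] *)
qed

text \<open>A symmetric density is its own mirror image, so each cross-parity covariance equals its
  own negative.\<close>

lemma cross_cov_symmetric:
  assumes f: "prob_density f" "density_symmetric_about c f"
    and e: "\<forall>g\<in>set \<phi>. g \<in> borel_measurable borel \<and> even_about c g"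
    and o: "\<forall>g\<in>set \<psi>. g \<in> borel_measurable borel \<and> odd_about c g"
  shows "cross_cov f \<phi> \<psi> = 0\<^sub>m (length \<phi>) (length \<psi>)"
    and "cross_cov f \<psi> \<phi> = 0\<^sub>m (length \<psi>) (length \<phi>)"
proof -
  have "AE x in lborel. f x = f (2 * c - x)"
    using f(2) by (auto simp: density_symmetric_about_def eq_commute)
  note Cov = Cov_even_odd[OF f(1) f(1) this]
  have *: "Cov f (\<phi> ! i) (\<psi> ! j) = 0" if "i < length \<phi>" "j < length \<psi>" for i j
    using Cov[of "\<phi> ! i" "\<psi> ! j"] e o that by simp
  show "cross_cov f \<phi> \<psi> = 0\<^sub>m (length \<phi>) (length \<psi>)"
    by (rule eq_matI) (auto simp: cross_cov_def *)
  show "cross_cov f \<psi> \<phi> = 0\<^sub>m (length \<psi>) (length \<phi>)"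
    by (rule eq_matI) (auto simp: cross_cov_def Cov_commute[of _ "\<psi> ! _"] *)
qed

lemma Mean_odd_symmetric:
  assumes "prob_density f" "density_symmetric_about c f"
    and "g \<in> borel_measurable borel" "odd_about c g"
  shows "Mean f g = 0"
proof -
  have "AE x in lborel. f x = f (2 * c - x)"
    using assms(2) by (auto simp: density_symmetric_about_def eq_commute)
  from Mean_odd[OF assms(1,1) this assms(3,4)] show ?thesis by simp
qed

lemma Y_vec_odd_symmetric:
  assumes "prob_density f0" "density_symmetric_about c f0"
    and "prob_density f1" "density_symmetric_about c f1"
    and "\<forall>g\<in>set \<psi>. g \<in> borel_measurable borel \<and> odd_about c g"
  shows "Y_vec f0 f1 \<psi> = 0\<^sub>v (length \<psi>)"
  using assms by (intro eq_vecI) (auto simp: Y_vec_def mean_vec_def Mean_odd_symmetric)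

lemma Y_vec_even_mirror:
  assumes f: "prob_density f0" "prob_density f1" "AE x in lborel. f1 x = f0 (2 * c - x)"
    and "\<forall>g\<in>set \<phi>. g \<in> borel_measurable borel \<and> even_about c g"
  shows "Y_vec f0 f1 \<phi> = 0\<^sub>v (length \<phi>)"
  using assms(4) by (intro eq_vecI) (auto simp: Y_vec_def mean_vec_def Mean_even[OF f])

section \<open>The clipped linear column\<close>

lemma borel_measurable_clipped_lin [measurable]: "clipped_lin M c \<in> borel_measurable borel"
  unfolding clipped_lin_def clip_def by measurable

lemma odd_about_clipped_lin: "0 < M \<Longrightarrow> odd_about c (clipped_lin M c)"
  by (auto simp: odd_about_def clipped_lin_def clip_def max_def min_def)

lemma clipped_lin_eq_0_iff: "0 < M \<Longrightarrow> clipped_lin M c x = 0 \<longleftrightarrow> x = c"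
  by (auto simp: clipped_lin_def clip_def max_def min_def)

text \<open>With mean zero, a vanishing variance would concentrate the law at \<open>c\<close>, but
  a law with a density has no atoms. This provides the nonzero denominator for the linear column
  alone under common symmetry.\<close>

lemma Cov_clipped_lin_pos:
  assumes M: "0 < M" and f: "prob_density f" and mean: "Mean f (clipped_lin M c) = 0"
  shows "Cov f (clipped_lin M c) (clipped_lin M c) > 0"
proof (rule ccontr)
  let ?l = "clipped_lin M c"
  interpret prob_space "law f" using f by (simp add: prob_density_def)
  have [measurable]: "f \<in> borel_measurable borel" using f by (simp add: prob_density_def)
  have bound: "\<bar>?l x\<bar> \<le> M" for x
    using M by (auto simp: clipped_lin_def clip_def)
  \<comment> \<open>Clipping bounds the square by \<open>M * M\<close>; integrability is needed to
    pass from a zero integral to a function that is zero almost everywhere.\<close>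
  have int: "integrable (law f) (\<lambda>x. ?l x * ?l x)"
  proof (rule integrable_const_bound[where B = "M * M"])
    show "AE x in law f. norm (?l x * ?l x) \<le> M * M"
    proof (intro AE_I2)
      show "norm (?l x * ?l x) \<le> M * M" for x
        unfolding real_norm_def abs_mult
        using M by (intro mult_mono[OF bound bound]) auto
    qed
  qed auto
  assume "\<not> Cov f ?l ?l > 0"
  moreover have "(\<integral>x. ?l x * ?l x \<partial>law f) \<ge> 0" by (intro integral_nonneg_AE AE_I2) simp
  ultimately have "(\<integral>x. ?l x * ?l x \<partial>law f) = 0"
    unfolding Cov_def mean by (simp add: Mean_def)
  then have "AE x in law f. ?l x * ?l x = 0"
    using integral_nonneg_eq_0_iff_AE[OF int] by simp
  then have "AE x in law f. x = c"
    using M by (simp add: clipped_lin_eq_0_iff)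
  moreover have "AE x in law f. x \<noteq> c"
    by (subst AE_density) (auto intro: AE_mp[OF AE_lborel_singleton[of c]])
  ultimately have "AE x in law f. False" by eventually_elim simp
  then show False by simp
qed

text \<open>The odd block consists of the linear column alone, so everything reduces to a 1 by 1
  form.\<close>

lemma J_even_clipped_lin_mirror:
  assumes M: "0 < M" and f: "prob_density f0" "prob_density f1"
    and mirror: "AE x in lborel. f1 x = f0 (2 * c - x)"
    and even: "\<forall>g\<in>set \<psi>. even_about c g"
    and mom: "moment_assumption f0 f1 (\<psi> @ [clipped_lin M c])"
  shows "J f0 f1 (\<psi> @ [clipped_lin M c]) =
      2 * (Mean f0 (clipped_lin M c))\<^sup>2 / Var f0 (clipped_lin M c)"
    and "0 < Var f0 (clipped_lin M c)"
proof -
  let ?l = "clipped_lin M c"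
  have e: "\<forall>g\<in>set \<psi>. g \<in> borel_measurable borel \<and> even_about c g"
    using even mom by (auto simp: moment_assumption_def)
  have o: "\<forall>g\<in>set [?l]. g \<in> borel_measurable borel \<and> odd_about c g"
    using odd_about_clipped_lin[OF M] by simp
  have J: "J f0 f1 (\<psi> @ [?l]) = J f0 f1 [?l]"
    by (rule J_append_snd[OF f(2) mom cross_cov_mirror[OF f mirror e o]
          Y_vec_even_mirror[OF f mirror e]])
  have "pos_def_mat (cov_mat f0 [?l])"
    using moment_assumption_appendD(2)[OF mom] by (simp add: moment_assumption_def)
  then have "cov_mat f0 [?l] $$ (0,0) > 0"
    by (rule pos_def_mat_1x1) (simp add: cov_mat_def)
  then have pos: "Cov f0 ?l ?l > 0" by (simp add: cov_mat_def)
  then show "0 < Var f0 ?l" by (simp add: Var_eq_Cov)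
  \<comment> \<open>The mean difference is minus twice the mean under \<open>f0\<close> and the
    variances add up to twice one of them; 4 over 2 is the constant in the formula.\<close>
  have "Cov f1 ?l ?l = Cov f0 ?l ?l" "Mean f1 ?l = - Mean f0 ?l"
    using o by (simp_all add: Cov_odd_odd[OF f mirror] Mean_odd[OF f mirror])
  then show "J f0 f1 (\<psi> @ [?l]) = 2 * (Mean f0 ?l)\<^sup>2 / Var f0 ?l"
    unfolding J using pos
    by (simp add: J_singleton Var_eq_Cov power2_eq_square field_simps)
qed

section \<open>Assembly of the common-symmetry and mirror-pair cases\<close>

theorem theorem4p1:
  fixes f0 f1 :: "real \<Rightarrow> real" and \<phi> \<phi>e \<phi>o :: dictionary and M c :: real
  assumes "0 < M"
    and "prob_density f0" and "prob_density f1"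
    and "clipped_dictionary M \<phi>" and "moment_assumption f0 f1 \<phi>"
    and "\<phi> = \<phi>e @ \<phi>o"
    and "\<forall>g\<in>set \<phi>e. even_about c g" and "\<forall>g\<in>set \<phi>o. odd_about c g"
    and "split_block (F_mat f0 f1 \<phi>) (length \<phi>e) (length \<phi>e) = (Fee, Feo, Foe, Foo)"
    and "split_block (cov_mat f0 \<phi>) (length \<phi>e) (length \<phi>e) = (C0ee, C0eo, C0oe, C0oo)"
    and "split_block (cov_mat f1 \<phi>) (length \<phi>e) (length \<phi>e) = (C1ee, C1eo, C1oe, C1oo)"
    and "Ye = vec_first (Y_vec f0 f1 \<phi>) (length \<phi>e)"
    and "Yo = vec_last (Y_vec f0 f1 \<phi>) (length \<phi>o)"
  shows
    "(density_symmetric_about c f0 \<and> density_symmetric_about c f1 \<longrightarrow>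
        Yo = 0\<^sub>v (length \<phi>o) \<and>
        Feo = 0\<^sub>m (length \<phi>e) (length \<phi>o) \<and> Foe = 0\<^sub>m (length \<phi>o) (length \<phi>e) \<and>
        J f0 f1 \<phi> = inv_quad_form Fee Ye \<and> J f0 f1 \<phi>e = inv_quad_form Fee Ye \<and>
        (\<forall>\<psi>. clipped_dictionary M \<psi> \<and> moment_assumption f0 f1 \<psi> \<and>
              (\<forall>g\<in>set \<psi>. odd_about c g) \<longrightarrow> J f0 f1 \<psi> = 0) \<and>
        J f0 f1 [clipped_lin M c] = 0)
     \<and>
     ((\<forall>x. f1 x = f0 (2 * c - x)) \<longrightarrow>
        Ye = 0\<^sub>v (length \<phi>e) \<and>
        C0eo + C1eo = 0\<^sub>m (length \<phi>e) (length \<phi>o) \<and> C0oe + C1oe = 0\<^sub>m (length \<phi>o) (length \<phi>e) \<and>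
        Feo = 0\<^sub>m (length \<phi>e) (length \<phi>o) \<and> Foe = 0\<^sub>m (length \<phi>o) (length \<phi>e) \<and>
        J f0 f1 \<phi> = inv_quad_form Foo Yo \<and>
        (\<forall>\<psi>. clipped_dictionary M \<psi> \<and> (\<forall>g\<in>set \<psi>. even_about c g) \<and>
              moment_assumption f0 f1 (\<psi> @ [clipped_lin M c]) \<longrightarrow>
            J f0 f1 (\<psi> @ [clipped_lin M c]) =
              2 * (Mean f0 (clipped_lin M c))\<^sup>2 / Var f0 (clipped_lin M c) \<and>
            (J f0 f1 (\<psi> @ [clipped_lin M c]) = 0 \<longleftrightarrow> Mean f0 (clipped_lin M c) = 0)))"
proof -
  note M = assms(1) and f = assms(2,3) and mom = assms(5)
  have split: "\<phi> = \<phi>e @ \<phi>o" by fact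
  note mom' = mom[unfolded split]
  have e: "\<forall>g\<in>set \<phi>e. g \<in> borel_measurable borel \<and> even_about c g"
    and o: "\<forall>g\<in>set \<phi>o. g \<in> borel_measurable borel \<and> odd_about c g"
    using assms(6-8) mom by (auto simp: moment_assumption_def)
  have F: "Fee = F_mat f0 f1 \<phi>e" "Feo = cross_cov f0 \<phi>e \<phi>o + cross_cov f1 \<phi>e \<phi>o"
    "Foe = cross_cov f0 \<phi>o \<phi>e + cross_cov f1 \<phi>o \<phi>e" "Foo = F_mat f0 f1 \<phi>o"
    using assms(9) unfolding split F_mat_append
    by (simp_all add: split_block_four_block_mat[where m = "length \<phi>o" and l = "length \<phi>o"])
  have C0: "C0eo = cross_cov f0 \<phi>e \<phi>o" "C0oe = cross_cov f0 \<phi>o \<phi>e"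
    using assms(10) unfolding split cov_mat_append
    by (simp_all add: split_block_four_block_mat[where m = "length \<phi>o" and l = "length \<phi>o"])
  have C1: "C1eo = cross_cov f1 \<phi>e \<phi>o" "C1oe = cross_cov f1 \<phi>o \<phi>e"
    using assms(11) unfolding split cov_mat_append
    by (simp_all add: split_block_four_block_mat[where m = "length \<phi>o" and l = "length \<phi>o"])
  have Ye: "Ye = Y_vec f0 f1 \<phi>e"
    unfolding assms(12) split Y_vec_append
    by (intro eq_vecI) (auto simp: vec_first_def)
  have Yo: "Yo = Y_vec f0 f1 \<phi>o"
    unfolding assms(13) split Y_vec_append
    by (intro eq_vecI) (auto simp: vec_last_def)
  show ?thesis
  \<comment> \<open>The pattern splits only the outer conjunction of two implications and leaves the
    conjunctions inside them intact.\<close>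
  proof (intro conjI[of "_ \<longrightarrow> _"] impI, goal_cases)
    case 1
    then have s: "density_symmetric_about c f0" "density_symmetric_about c f1" by auto
    note zero0 = cross_cov_symmetric[OF f(1) s(1) e o]
    note zero1 = cross_cov_symmetric[OF f(2) s(2) e o]
    have zero: "cross_cov f0 \<phi>e \<phi>o + cross_cov f1 \<phi>e \<phi>o = 0\<^sub>m (length \<phi>e) (length \<phi>o)"
      "cross_cov f0 \<phi>o \<phi>e + cross_cov f1 \<phi>o \<phi>e = 0\<^sub>m (length \<phi>o) (length \<phi>e)"
      by (simp_all add: zero0 zero1)
    note Yo0 = Y_vec_odd_symmetric[OF f(1) s(1) f(2) s(2)]
    have J\<phi>: "J f0 f1 \<phi> = J f0 f1 \<phi>e"
      unfolding split by (rule J_append_fst[OF f(2) mom' zero Yo0[OF o]])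
    \<comment> \<open>For an all-odd dictionary \<open>Y\<close> is the zero vector, and
      \<open>F\<close> is still invertible by its own moment assumption.\<close>
    have J\<psi>: "J f0 f1 \<psi> = 0"
      if "moment_assumption f0 f1 \<psi>" "\<forall>g\<in>set \<psi>. odd_about c g" for \<psi>
    proof -
      have "Y_vec f0 f1 \<psi> = 0\<^sub>v (length \<psi>)"
        using that by (intro Yo0) (auto simp: moment_assumption_def)
      moreover have "det (F_mat f0 f1 \<psi>) \<noteq> 0"
        by (rule pos_def_mat_det[OF pos_def_F_mat[OF f(2) that(1)] carrier_cov(3)])
      ultimately show ?thesis by (simp add: J_def inv_quad_form_zero_vec[OF carrier_cov(3)])
    qed
    have mean: "Mean f0 (clipped_lin M c) = 0" "Mean f1 (clipped_lin M c) = 0"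
      using f s odd_about_clipped_lin[OF M] by (simp_all add: Mean_odd_symmetric)
    \<comment> \<open>The denominator is positive by the absence of atoms, and both means in the
      numerator vanish.\<close>
    have "J f0 f1 [clipped_lin M c] = 0"
      using Cov_clipped_lin_pos[OF M f(1) mean(1)] Cov_clipped_lin_pos[OF M f(2) mean(2)]
      by (subst J_singleton) (auto simp: mean)
    then show ?case
      using zero J\<phi> J\<psi> Yo0[OF o] by (simp add: F Ye Yo J_def[of f0 f1 \<phi>e])
  next
    case 2
    then have m: "AE x in lborel. f1 x = f0 (2 * c - x)" by simp
    note zero = cross_cov_mirror[OF f m e o]
    note Ye0 = Y_vec_even_mirror[OF f m e]
    have "J f0 f1 \<phi> = J f0 f1 \<phi>o"
      unfolding split by (rule J_append_snd[OF f(2) mom' zero Ye0])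
    moreover have "J f0 f1 (\<psi> @ [clipped_lin M c]) =
          2 * (Mean f0 (clipped_lin M c))\<^sup>2 / Var f0 (clipped_lin M c) \<and>
        (J f0 f1 (\<psi> @ [clipped_lin M c]) = 0 \<longleftrightarrow> Mean f0 (clipped_lin M c) = 0)"
      if "\<forall>g\<in>set \<psi>. even_about c g" "moment_assumption f0 f1 (\<psi> @ [clipped_lin M c])" for \<psi>
      using J_even_clipped_lin_mirror[OF M f m that] by simp
    ultimately show ?case
      unfolding F C0 C1 Ye Yo J_def[of f0 f1 \<phi>o, symmetric]
      using zero Ye0 by (intro conjI) blast+
  qed
qed

end
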